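(* Let $n\ge 1$, let $Q$ be a real quadratic form on $\mathbb{R}^n$, and let $2\le p<\infty$. For any $q$ with $p<q\le\infty$ there exists a constant $C_1>1$ such that for all $R>1$ $$\mathcal{C}_\infty(R)\le \mathcal{C}_q(R)\le C_1\,\mathcal{C}_\infty(R).$$
   Context: Let $\Omega=[0,1]^n$. $Q$ is an arbitrary quadratic form on $\mathbb{R}^n$ (no restriction on signature or eigenvalues), and $S=\{(\xi,Q(\xi)):\xi\in\Omega\}$. Functions on $S$ are identified with functions on $\Omega$, and $L^q(S)$ means $L^q(\Omega)$ with Lebesgue measure. The extension operator is $$\mathcal{E}(f)(x,t)=\int_\Omega f(\xi)\,e^{i(x\cdot\xi+tQ(\xi))}\,d\xi,\qquad (x,t)\in\mathbb{R}^n\times\mathbb{R}.$$ $D$ is the set of measurable functions $f:\Omega\to\{0\}\cup\{z\in\mathbb{C}:|z|=1\}$. For $R>0$ put $T_R=\mathbb{R}^n\times[-R,R]\subset\mathbb{R}^{n+1}$. With $p$ fixed, for $1\le q\le\infty$, $\mathcal{C}_q(R)$ denotes the best (smallest) constant $C$ such that $\|\mathcal{E}f\|_{L^p(T_R)}\le C\|f\|_{L^q(S)}$ for all $f\in D$. (The dependence of $\mathcal{C}_q(R)$ on $p$, $n$, $Q$ is suppressed.) *)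

theory Defs
  imports "HOL-Analysis.Analysis" "HOL-Probability.Essential_Supremum"
begin

definition quadratic_form :: "('a::real_vector \<Rightarrow> real) \<Rightarrow> bool" where
  "quadratic_form Q \<longleftrightarrow> (\<exists>B. bilinear B \<and> (\<forall>x. Q x = B x x))"

definition unit_cube :: "(real ^ 'n) set" where
  "unit_cube = {\<xi>. \<forall>i. 0 \<le> \<xi> $ i \<and> \<xi> $ i \<le> 1}"

(* The L^p (quasi-)norm for 0 < p \<le> \<infinity>, with value \<infinity> allowed.  The library has no power
   function on ennreal, so the p-th root of the integral is taken in the reals, with
   the infinite case treated separately. *)
definition Lp_norm :: "'a measure \<Rightarrow> ennreal \<Rightarrow> ('a \<Rightarrow> complex) \<Rightarrow> ennreal" where
  "Lp_norm M p f =
     (if p = \<infinity> then esssup M (\<lambda>x. ennreal (norm (f x)))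
      else let I = (\<integral>\<^sup>+ x. ennreal (norm (f x) powr enn2real p) \<partial>M)
           in if I = \<infinity> then \<infinity> else ennreal (enn2real I powr (1 / enn2real p)))"

definition extension_op ::
    "(real ^ 'n \<Rightarrow> real) \<Rightarrow> (real ^ 'n \<Rightarrow> complex) \<Rightarrow> (real ^ 'n) \<times> real \<Rightarrow> complex" where
  "extension_op Q f = (\<lambda>(x, t).
     LINT \<xi>|lebesgue_on unit_cube. f \<xi> * exp (\<i> * complex_of_real (x \<bullet> \<xi> + t * Q \<xi>)))"

(* A function on the cube is represented by a function on the whole space whose values
   off the cube are arbitrary; they are never used. *)
definition unimodular_or_zero :: "(real ^ 'n \<Rightarrow> complex) set" where
  "unimodular_or_zero =
     {f. f \<in> borel_measurable (lebesgue_on unit_cube) \<and>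
         (\<forall>\<xi>\<in>unit_cube. f \<xi> = 0 \<or> norm (f \<xi>) = 1)}"

definition slab :: "real \<Rightarrow> ((real ^ 'n) \<times> real) set" where
  "slab R = UNIV \<times> {-R..R}"

(* Infimum taken in [0,\<infinity>]: the value is \<infinity> exactly when no finite constant is admissible. *)
definition best_const :: "(real ^ 'n \<Rightarrow> real) \<Rightarrow> real \<Rightarrow> ennreal \<Rightarrow> real \<Rightarrow> ennreal" where
  "best_const Q p q R =
     Inf {C. \<forall>f\<in>unimodular_or_zero.
            Lp_norm (lebesgue_on (slab R)) (ennreal p) (extension_op Q f)
              \<le> C * Lp_norm (lebesgue_on unit_cube) q f}"

end

theory Submission
  imports Defs "HOL-Probability.Probability_Measure"
begin

text \<open>Let \<open>K\<close> be the supremum of \<open>\<parallel>E F\<parallel>\<^sup>p\<close> over the class \<open>D\<close>. Given \<open>F\<close> and \<open>f\<close> in \<open>D\<close>, translate \<open>f\<close> by a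
  random \<open>\<eta>\<close> uniform in \<open>[-1,1]\<^sup>n\<close>, truncate the translate \<open>h\<close> to the cube, and let \<open>g\<close> be \<open>F\<close> with
  the support of the translate removed. Then \<open>g + h\<close> and \<open>g - h\<close> lie in \<open>D\<close>, and since \<open>p \<ge> 2\<close> the
  parallelogram inequality gives \<open>\<parallel>E g\<parallel>\<^sup>p + \<parallel>E h\<parallel>\<^sup>p \<le> K\<close>. A translation in frequency acts on \<open>E\<close>
  through a shear preserving the slab. A point of the cube is removed with a probability \<open>\<delta>\<close> at
  most \<open>|supp f|\<close> and retained by the truncation with probability \<open>c = 2\<^sup>-\<^sup>n\<close>, both independent
  of the point. Averaging over \<open>\<eta>\<close>, Jensen's inequality therefore yields
  \<open>(1 - \<delta>)\<^sup>p \<parallel>E F\<parallel>\<^sup>p + c\<^sup>p \<parallel>E f\<parallel>\<^sup>p \<le> K\<close>. Taking the supremum over \<open>F\<close> gives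
  \<open>c\<^sup>p \<parallel>E f\<parallel>\<^sup>p \<le> (1 - (1 - \<delta>)\<^sup>p) K \<le> p |supp f| K\<close>, even the endpoint \<open>q = p\<close>.\<close>

section \<open>Convexity inequalities for real powers\<close>

text \<open>A convex function lies above its tangents. Convexity is applied on the open half-line,
  so \<open>s = 0\<close> is checked separately. Later uses are the midpoint inequality, Jensen's
  inequality and, with \<open>a = 1\<close>, Bernoulli's inequality.\<close>

lemma powr_ge_tangent:
  fixes s a p :: real
  assumes "0 \<le> s" "0 < a" "1 \<le> p"
  shows "a powr p + p * a powr (p - 1) * (s - a) \<le> s powr p"
proof (cases "s = 0")
  case True
  have "a powr p = a powr (p - 1) * a"
    using powr_mult_base[of a "p - 1"] assms by (simp add: mult.commute)
  then have "a powr p + p * a powr (p - 1) * (s - a) = (1 - p) * a powr p"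
    using True by (simp add: algebra_simps)
  also have "\<dots> \<le> 0"
    using assms by (intro mult_nonpos_nonneg) auto
  finally show ?thesis using True by simp
next
  case False
  have "s powr p - a powr p \<ge> p * a powr (p - 1) * (s - a)"
  proof (rule convex_on_imp_above_tangent[OF powr_convex[OF assms(3)]])
    show "((\<lambda>x. x powr p) has_real_derivative p * a powr (p - 1)) (at a within {0<..})"
      using assms(2) by (auto intro!: derivative_eq_intros)
  qed (use assms False in \<open>auto simp: interior_open\<close>)
  then show ?thesis by simp
qed

lemma powr_add_superadditive:
  fixes x y r :: real
  assumes "0 \<le> x" "0 \<le> y" "1 \<le> r"
  shows "x powr r + y powr r \<le> (x + y) powr r"
proof (cases "x + y = 0")
  case True
  then have "x = 0" "y = 0" using assms by auto
  then show ?thesis by simp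
next
  case False
  \<comment> \<open>A ratio \<open>t = u / (x + y)\<close> in the unit interval satisfies
    \<open>t powr r \<le> t\<close>, and the ratios of \<open>x\<close> and \<open>y\<close> add up
    to 1.\<close>
  have *: "u powr r \<le> u / (x + y) * (x + y) powr r" if "0 \<le> u" "u \<le> x + y" for u
  proof -
    have "(u / (x + y)) powr r \<le> (u / (x + y)) powr 1"
      using that assms False by (intro powr_mono') auto
    then show ?thesis
      using that assms False by (simp add: powr_divide divide_simps)
  qed
  have "x powr r + y powr r \<le> x / (x + y) * (x + y) powr r + y / (x + y) * (x + y) powr r"
    using assms by (intro add_mono *) auto
  also have "\<dots> = (x + y) powr r"
    using False by (simp add: add_divide_distrib[symmetric] distrib_right[symmetric])
  finally show ?thesis .
qed

lemma powr_midpoint_le: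
  fixes x y r :: real
  assumes "0 \<le> x" "0 \<le> y" "1 \<le> r"
  shows "2 * ((x + y) / 2) powr r \<le> x powr r + y powr r"
proof (cases "x + y = 0")
  case True
  then have "x = 0" "y = 0" using assms by auto
  then show ?thesis by simp
next
  case False
  define m where "m = (x + y) / 2"
  have "0 < m" using assms False by (simp add: m_def)
  \<comment> \<open>Both tangent bounds are taken at the mean, so their linear terms cancel in the
    sum.\<close>
  have "m powr r + r * m powr (r - 1) * (x - m) \<le> x powr r"
    "m powr r + r * m powr (r - 1) * (y - m) \<le> y powr r"
    using assms \<open>0 < m\<close> by (auto intro!: powr_ge_tangent)
  moreover have "r * m powr (r - 1) * (x - m) + r * m powr (r - 1) * (y - m) = 0"
    by (simp add: m_def flip: distrib_left)
  ultimately show ?thesis by (simp add: m_def)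
qed

text \<open>A Clarkson-type inequality. Apply to the squared norms, with exponent
  \<open>p / 2 \<ge> 1\<close>, first superadditivity, then the parallelogram law, then midpoint
  convexity.\<close>

lemma norm_powr_parallelogram:
  fixes a b :: "'a::real_inner" and p :: real
  assumes "2 \<le> p"
  shows "2 * (norm a powr p + norm b powr p) \<le> norm (a + b) powr p + norm (a - b) powr p"
proof -
  have pw: "norm c powr p = ((norm c)\<^sup>2) powr (p / 2)" for c :: 'a
  proof -
    have "(norm c)\<^sup>2 = norm c powr 2" by simp
    then show ?thesis by (simp only: powr_powr) simp
  qed
  have "2 * (norm a powr p + norm b powr p) \<le> 2 * ((norm a)\<^sup>2 + (norm b)\<^sup>2) powr (p / 2)"
    unfolding pw using assms by (intro mult_left_mono powr_add_superadditive) auto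
  also have "(norm a)\<^sup>2 + (norm b)\<^sup>2 = ((norm (a + b))\<^sup>2 + (norm (a - b))\<^sup>2) / 2"
    by (simp add: power2_norm_eq_inner inner_simps inner_commute)
  also have "2 * \<dots> powr (p / 2) \<le> norm (a + b) powr p + norm (a - b) powr p"
    unfolding pw using assms by (intro powr_midpoint_le) auto
  finally show ?thesis .
qed

text \<open>Jensen's inequality: take expectations in the tangent bound at the mean \<open>a\<close>
  of \<open>norm (g x)\<close>, where the linear term averages to 0. The bound \<open>B\<close>
  supplies the integrability.\<close>

lemma (in prob_space) norm_expectation_powr_le:
  fixes g :: "'a \<Rightarrow> complex" and p :: real
  assumes [measurable]: "g \<in> borel_measurable M"
    and bound: "\<And>x. x \<in> space M \<Longrightarrow> norm (g x) \<le> B" and p: "1 \<le> p"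
  shows "ennreal (norm (expectation g) powr p) \<le> (\<integral>\<^sup>+x. ennreal (norm (g x) powr p) \<partial>M)"
proof -
  define a where "a = expectation (\<lambda>x. norm (g x))"
  have a0: "0 \<le> a" by (simp add: a_def)
  have int1: "integrable M (\<lambda>x. norm (g x))"
    by (rule integrable_const_bound[where B = B]) (auto intro!: AE_I2 bound)
  have intp: "integrable M (\<lambda>x. norm (g x) powr p)"
    by (rule integrable_const_bound[where B = "B powr p"])
      (use p in \<open>auto intro!: AE_I2 powr_mono2 bound\<close>)
  have "norm (expectation g) \<le> a"
    unfolding a_def by (rule integral_norm_bound)
  then have "norm (expectation g) powr p \<le> a powr p"
    using p by (intro powr_mono2) auto
  also have "a powr p \<le> expectation (\<lambda>x. norm (g x) powr p)"
  proof (cases "a = 0")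
    case True
    then show ?thesis by simp
  next
    case False
    have "a powr p = expectation (\<lambda>x. a powr p + p * a powr (p - 1) * (norm (g x) - a))"
      using int1 by (simp add: a_def prob_space)
    also have "\<dots> \<le> expectation (\<lambda>x. norm (g x) powr p)"
      using int1 intp False a0 p by (intro integral_mono powr_ge_tangent) auto
    finally show ?thesis .
  qed
  finally show ?thesis
    using intp by (simp add: nn_integral_eq_integral ennreal_leI)
qed

section \<open>The extension operator, its energy, and the Borel form of the class
  \<open>D\<close>\<close>

definition wave :: "('a::euclidean_space \<Rightarrow> real) \<Rightarrow> 'a \<times> real \<Rightarrow> 'a \<Rightarrow> complex" where
  "wave Q z \<xi> = exp (\<i> * complex_of_real (fst z \<bullet> \<xi> + snd z * Q \<xi>))"

text \<open>The cube does not appear in the integral, so the operator also applies to translates;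
  functions on the cube enter extended by zero.\<close>

definition fourier_ext :: "('a::euclidean_space \<Rightarrow> real) \<Rightarrow> ('a \<Rightarrow> complex) \<Rightarrow> 'a \<times> real \<Rightarrow> complex" where
  "fourier_ext Q f z = (LINT \<xi>|lborel. f \<xi> * wave Q z \<xi>)"

text \<open>The \<open>p\<close>-th power of the \<open>L^p\<close> norm over the slab. As an
  \<open>ennreal\<close> it can be added and averaged before anything is known to be finite.\<close>

definition energy :: "('a::euclidean_space \<Rightarrow> real) \<Rightarrow> real \<Rightarrow> real \<Rightarrow> ('a \<Rightarrow> complex) \<Rightarrow> ennreal" where
  "energy Q p R f = (\<integral>\<^sup>+z. ennreal (norm (fourier_ext Q f z) powr p) * indicator (UNIV \<times> {-R..R}) z \<partial>lborel)"

lemma norm_wave [simp]: "norm (wave Q z \<xi>) = 1"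
  by (simp add: wave_def norm_exp_i_times)

lemma wave_measurable [measurable]:
  assumes [measurable]: "Q \<in> borel_measurable borel" "f \<in> borel_measurable M" "g \<in> borel_measurable M"
  shows "(\<lambda>x. wave Q (f x) (g x)) \<in> borel_measurable M"
proof -
  have [measurable]: "f \<in> M \<rightarrow>\<^sub>M borel \<Otimes>\<^sub>M borel"
    using assms(2) by (simp add: borel_prod)
  have [measurable]: "g \<in> M \<rightarrow>\<^sub>M borel" by fact
  show ?thesis unfolding wave_def by measurable
qed

lemma fourier_ext_measurable:
  assumes [measurable]: "Q \<in> borel_measurable borel"
    "(\<lambda>(\<eta>, \<xi>). G \<eta> \<xi>) \<in> borel_measurable (M \<Otimes>\<^sub>M lborel)"
  shows "(\<lambda>(\<eta>, z). fourier_ext Q (G \<eta>) z) \<in> borel_measurable (M \<Otimes>\<^sub>M borel)"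
  unfolding fourier_ext_def by measurable

lemma fourier_ext_measurable_borel [measurable]:
  assumes [measurable]: "Q \<in> borel_measurable borel" "f \<in> borel_measurable borel"
  shows "fourier_ext Q f \<in> borel_measurable borel"
  unfolding fourier_ext_def[abs_def] by measurable

text \<open>Borel representatives of the class \<open>D\<close>, extended by zero: Borel rather than Lebesgue measurable
  because \<open>f (\<xi> - \<eta>)\<close> need not be measurable for the product of the completed measures.\<close>

definition phases :: "(real ^ 'n \<Rightarrow> complex) set" where
  "phases = {f \<in> borel_measurable borel. \<forall>\<xi>. f \<xi> = 0 \<or> \<xi> \<in> unit_cube \<and> norm (f \<xi>) = 1}"

lemma phases_measurable: "f \<in> phases \<Longrightarrow> f \<in> borel_measurable borel"
  by (simp add: phases_def)

lemma phases_eq_0: "f \<in> phases \<Longrightarrow> \<xi> \<notin> unit_cube \<Longrightarrow> f \<xi> = 0"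
  by (auto simp: phases_def)

lemma norm_phases_le: "f \<in> phases \<Longrightarrow> norm (f \<xi>) \<le> indicator unit_cube \<xi>"
  by (auto simp: phases_def indicator_def) (metis norm_zero order.refl zero_le_one)+

lemma unit_cube_eq_cbox: "unit_cube = cbox 0 (1 :: real ^ 'n)"
  by (auto simp: unit_cube_def mem_box_cart)

lemma unit_cube_borel [measurable]: "unit_cube \<in> sets borel"
  by (simp add: unit_cube_eq_cbox)

lemma emeasure_unit_cube: "emeasure lborel (unit_cube :: (real ^ 'n) set) = 1"
proof -
  have "1 \<bullet> b = 1" if "b \<in> Basis" for b :: "real ^ 'n"
    using that by (auto simp: Basis_vec_def inner_axis)
  then show ?thesis
    by (simp add: unit_cube_eq_cbox emeasure_lborel_cbox_eq)
qed

lemma strip_borel [measurable]: "UNIV \<times> {-R..R::real} \<in> sets borel"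
  by (intro borel_closed closed_Times) auto

lemma phases_if:
  assumes "f \<in> phases" and [measurable]: "Measurable.pred borel P"
  shows "(\<lambda>\<xi>. if P \<xi> then f \<xi> else 0) \<in> phases"
proof -
  have [measurable]: "f \<in> borel_measurable borel" using assms(1) by (rule phases_measurable)
  show ?thesis using assms(1) by (auto simp: phases_def)
qed

lemma integrable_phases:
  assumes "f \<in> phases" and [measurable]: "Q \<in> borel_measurable borel"
  shows "integrable lborel (\<lambda>\<xi>. f \<xi> * wave Q z \<xi>)"
proof (rule Bochner_Integration.integrable_bound)
  have [measurable]: "f \<in> borel_measurable borel" using assms(1) by (rule phases_measurable)
  show "integrable lborel (\<lambda>\<xi>::real^'a. indicator unit_cube \<xi> :: real)"
    by (simp add: emeasure_unit_cube)
  show "(\<lambda>\<xi>. f \<xi> * wave Q z \<xi>) \<in> borel_measurable lborel" by measurable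
  show "AE \<xi> in lborel. norm (f \<xi> * wave Q z \<xi>) \<le> norm (indicator unit_cube \<xi> :: real)"
    using norm_phases_le[OF assms(1)] by (simp add: norm_mult)
qed

lemma norm_fourier_ext_le:
  assumes "f \<in> phases" and [measurable]: "Q \<in> borel_measurable borel"
  shows "norm (fourier_ext Q f z) \<le> 1"
proof -
  have "norm (fourier_ext Q f z) \<le> (LINT \<xi>|lborel. norm (f \<xi> * wave Q z \<xi>))"
    unfolding fourier_ext_def by (rule integral_norm_bound)
  also have "\<dots> \<le> (LINT \<xi>|lborel. indicator (unit_cube :: (real^'a) set) \<xi>)"
    using norm_phases_le[OF assms(1)]
    by (intro integral_mono integrable_norm integrable_phases assms)
      (auto simp: norm_mult emeasure_unit_cube)
  also have "\<dots> = 1" by (simp add: measure_def emeasure_unit_cube)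
  finally show ?thesis .
qed

section \<open>Averaging over random restrictions\<close>

text \<open>Every point of the cube survives with the same probability, so the mean of the
  restricted functions is \<open>\<kappa>\<close> times \<open>F\<close>, and by linearity the same
  holds after extension. Jensen's inequality at each \<open>z\<close>, followed by Tonelli, gives
  the bound.\<close>

lemma (in prob_space) energy_average_ge:
  fixes F :: "real ^ 'n \<Rightarrow> complex"
  assumes [measurable]: "Q \<in> borel_measurable borel"
    and F: "F \<in> phases"
    and S [measurable]: "Measurable.pred (M \<Otimes>\<^sub>M borel) (\<lambda>(\<eta>, \<xi>). S \<eta> \<xi>)"
    and \<kappa>: "\<And>\<xi>. \<xi> \<in> unit_cube \<Longrightarrow> prob {\<eta> \<in> space M. S \<eta> \<xi>} = \<kappa>" "0 \<le> \<kappa>"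
    and p: "1 \<le> p"
  shows "ennreal (\<kappa> powr p) * energy Q p R F
           \<le> (\<integral>\<^sup>+\<eta>. energy Q p R (\<lambda>\<xi>. if S \<eta> \<xi> then F \<xi> else 0) \<partial>M)"
proof -
  define G where "G \<eta> \<xi> = (if S \<eta> \<xi> then F \<xi> else 0)" for \<eta> \<xi>
  interpret P: pair_sigma_finite M "lborel :: (real^'n) measure" ..
  interpret P': pair_sigma_finite M "lborel :: ((real^'n) \<times> real) measure" ..
  have [measurable]: "F \<in> borel_measurable borel" using F by (rule phases_measurable)
  have G [measurable]: "(\<lambda>(\<eta>, \<xi>). G \<eta> \<xi>) \<in> borel_measurable (M \<Otimes>\<^sub>M lborel)"
    unfolding G_def by measurable
  have G' [measurable]: "(\<lambda>(\<eta>, z). fourier_ext Q (G \<eta>) z) \<in> borel_measurable (M \<Otimes>\<^sub>M borel)"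
    by (rule fourier_ext_measurable) measurable
  have Gph: "G \<eta> \<in> phases" if "\<eta> \<in> space M" for \<eta>
    unfolding G_def using that by (intro phases_if F) measurable
  have avg: "expectation (\<lambda>\<eta>. fourier_ext Q (G \<eta>) z) = complex_of_real \<kappa> * fourier_ext Q F z" for z
  proof -
    \<comment> \<open>Domination by the indicator of a set of product measure 1 justifies exchanging
      the expectation with the integral over the frequency.\<close>
    have int: "integrable (M \<Otimes>\<^sub>M lborel) (\<lambda>(\<eta>, \<xi>). G \<eta> \<xi> * wave Q z \<xi>)"
    proof (rule Bochner_Integration.integrable_bound)
      show "integrable (M \<Otimes>\<^sub>M lborel) (\<lambda>x. indicator (space M \<times> (unit_cube :: (real^'n) set)) x :: real)"
        by (simp add: lborel.emeasure_pair_measure_Times emeasure_unit_cube emeasure_space_1)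
      show "AE x in M \<Otimes>\<^sub>M lborel. norm (case x of (\<eta>, \<xi>) \<Rightarrow> G \<eta> \<xi> * wave Q z \<xi>)
              \<le> norm (indicator (space M \<times> (unit_cube :: (real^'n) set)) x :: real)"
        using norm_phases_le[OF Gph]
        by (intro AE_I2) (auto simp: space_pair_measure norm_mult indicator_times)
    qed measurable
    have "expectation (\<lambda>\<eta>. fourier_ext Q (G \<eta>) z) = (LINT \<xi>|lborel. expectation (\<lambda>\<eta>. G \<eta> \<xi> * wave Q z \<xi>))"
      unfolding fourier_ext_def using P.Fubini_integral[OF int] by simp
    also have "\<dots> = (LINT \<xi>|lborel. complex_of_real \<kappa> * (F \<xi> * wave Q z \<xi>))"
    proof (rule Bochner_Integration.integral_cong[OF refl])
      fix \<xi> :: "real^'n"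
      have "expectation (\<lambda>\<eta>. G \<eta> \<xi> * wave Q z \<xi>)
          = expectation (\<lambda>\<eta>. of_real (indicator {\<eta> \<in> space M. S \<eta> \<xi>} \<eta>) * (F \<xi> * wave Q z \<xi>))"
        by (intro Bochner_Integration.integral_cong) (auto simp: G_def indicator_def)
      also have "\<dots> = complex_of_real (prob {\<eta> \<in> space M. S \<eta> \<xi>}) * (F \<xi> * wave Q z \<xi>)"
        by (simp add: emeasure_eq_measure)
      also have "\<dots> = complex_of_real \<kappa> * (F \<xi> * wave Q z \<xi>)"
        \<comment> \<open>Off the cube both sides vanish with \<open>F\<close>, so the survival
          probability matters only on the cube.\<close>
        using \<kappa>(1) phases_eq_0[OF F] by (cases "\<xi> \<in> unit_cube") auto
      finally show "expectation (\<lambda>\<eta>. G \<eta> \<xi> * wave Q z \<xi>) = \<dots>" .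
    qed
    also have "\<dots> = complex_of_real \<kappa> * fourier_ext Q F z"
      by (simp add: fourier_ext_def)
    finally show ?thesis .
  qed
  have "ennreal (\<kappa> powr p) * energy Q p R F
      = (\<integral>\<^sup>+z. ennreal (\<kappa> powr p) * (ennreal (norm (fourier_ext Q F z) powr p) * indicator (UNIV \<times> {-R..R}) z) \<partial>lborel)"
    unfolding energy_def by (intro nn_integral_cmult[symmetric]) measurable
  also have "\<dots> \<le> (\<integral>\<^sup>+z. (\<integral>\<^sup>+\<eta>. ennreal (norm (fourier_ext Q (G \<eta>) z) powr p) * indicator (UNIV \<times> {-R..R}) z \<partial>M) \<partial>lborel)"
  proof (rule nn_integral_mono)
    fix z :: "(real^'n) \<times> real"
    have [measurable]: "(\<lambda>\<eta>. fourier_ext Q (G \<eta>) z) \<in> borel_measurable M"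
      by measurable
    have "ennreal (\<kappa> powr p) * ennreal (norm (fourier_ext Q F z) powr p)
        = ennreal (norm (expectation (\<lambda>\<eta>. fourier_ext Q (G \<eta>) z)) powr p)"
      using \<kappa>(2) by (simp add: avg norm_mult powr_mult ennreal_mult)
    also have "\<dots> \<le> (\<integral>\<^sup>+\<eta>. ennreal (norm (fourier_ext Q (G \<eta>) z) powr p) \<partial>M)"
      by (rule norm_expectation_powr_le[where B = 1]) (auto intro!: norm_fourier_ext_le Gph p)
    finally have "ennreal (\<kappa> powr p) * ennreal (norm (fourier_ext Q F z) powr p) * indicator (UNIV \<times> {-R..R}) z
        \<le> (\<integral>\<^sup>+\<eta>. ennreal (norm (fourier_ext Q (G \<eta>) z) powr p) \<partial>M) * indicator (UNIV \<times> {-R..R}) z"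
      by (rule mult_right_mono) simp
    also have "\<dots> = (\<integral>\<^sup>+\<eta>. ennreal (norm (fourier_ext Q (G \<eta>) z) powr p) * indicator (UNIV \<times> {-R..R}) z \<partial>M)"
      by (intro nn_integral_multc[symmetric]) measurable
    finally show "ennreal (\<kappa> powr p) * (ennreal (norm (fourier_ext Q F z) powr p) * indicator (UNIV \<times> {-R..R}) z) \<le> \<dots>"
      by (simp add: mult.assoc)
  qed
  also have "\<dots> = (\<integral>\<^sup>+\<eta>. energy Q p R (G \<eta>) \<partial>M)"
    unfolding energy_def
    by (rule P'.Fubini') (use G' in \<open>simp add: case_prod_unfold borel_prod[symmetric]\<close>)
  finally show ?thesis unfolding G_def .
qed

lemma energy_measurable:
  fixes G :: "'a \<Rightarrow> real ^ 'n \<Rightarrow> complex"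
  assumes [measurable]: "Q \<in> borel_measurable borel"
    "(\<lambda>(\<eta>, \<xi>). G \<eta> \<xi>) \<in> borel_measurable (M \<Otimes>\<^sub>M borel)"
  shows "(\<lambda>\<eta>. energy Q p R (G \<eta>)) \<in> borel_measurable M"
proof -
  have [measurable]: "(\<lambda>(\<eta>, z). fourier_ext Q (G \<eta>) z) \<in> borel_measurable (M \<Otimes>\<^sub>M borel)"
    by (rule fourier_ext_measurable) measurable
  show ?thesis unfolding energy_def by measurable
qed

section \<open>Invariance of the energy under frequency translation\<close>

text \<open>The two cross terms of \<open>B\<close> together are linear in \<open>\<zeta>\<close>,
  hence an inner product with a fixed vector; \<open>adjoint \<phi> 1\<close> is that Riesz vector.
  It depends on \<open>\<eta>\<close> but not on \<open>\<zeta>\<close>.\<close>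

lemma quadratic_form_shift:
  fixes Q :: "'a::euclidean_space \<Rightarrow> real"
  assumes "quadratic_form Q"
  shows "\<exists>L. \<forall>\<zeta>. Q (\<zeta> + \<eta>) = Q \<zeta> + L \<bullet> \<zeta> + Q \<eta>"
proof -
  obtain B where B: "bilinear B" and Q: "\<And>x. Q x = B x x"
    using assms by (auto simp: quadratic_form_def)
  define \<phi> where "\<phi> \<zeta> = B \<zeta> \<eta> + B \<eta> \<zeta>" for \<zeta>
  have "linear \<phi>"
    using B unfolding \<phi>_def bilinear_def by (intro linear_compose_add) auto
  then have "\<phi> \<zeta> = adjoint \<phi> 1 \<bullet> \<zeta>" for \<zeta>
    using adjoint_works[of \<phi> \<zeta> 1] by (simp add: inner_commute)
  then show ?thesis
    using B by (intro exI[of _ "adjoint \<phi> 1"]) (simp add: Q \<phi>_def bilinear_ladd bilinear_radd)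
qed

lemma quadratic_form_borel:
  fixes Q :: "'a::euclidean_space \<Rightarrow> real"
  assumes "quadratic_form Q"
  shows "Q \<in> borel_measurable borel"
proof -
  obtain B where B: "bilinear B" and Q: "\<And>x. Q x = B x x"
    using assms by (auto simp: quadratic_form_def)
  then interpret bounded_bilinear B by (simp add: bilinear_conv_bounded_bilinear)
  have "continuous_on UNIV (\<lambda>x. B x x)"
    by (intro continuous_on continuous_on_id)
  then show ?thesis
    using Q by (simp add: borel_measurable_continuous_onI cong: measurable_cong)
qed

text \<open>Translation multiplies the extension by a unimodular factor and composes it with the
  shear sending \<open>(x, t)\<close> to \<open>(x + t *\<^sub>R L, t)\<close>. The shear preserves
  Lebesgue measure and the slab.\<close>

lemma energy_translate:
  fixes f :: "real ^ 'n \<Rightarrow> complex"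
  assumes Q: "quadratic_form Q" and f [measurable]: "f \<in> borel_measurable borel"
  shows "energy Q p R (\<lambda>\<xi>. f (\<xi> - \<eta>)) = energy Q p R f"
proof -
  note [measurable] = quadratic_form_borel[OF Q]
  obtain L where L: "\<And>\<zeta>. Q (\<zeta> + \<eta>) = Q \<zeta> + L \<bullet> \<zeta> + Q \<eta>"
    using quadratic_form_shift[OF Q] by blast
  define \<psi> where "\<psi> z = ennreal (norm (fourier_ext Q f z) powr p) * indicator (UNIV \<times> {-R..R}) z" for z
  have \<psi> [measurable]: "\<psi> \<in> borel_measurable (borel \<Otimes>\<^sub>M borel)"
    by (simp add: borel_prod \<psi>_def[abs_def])
  have wave_shift: "wave Q (x, t) (\<zeta> + \<eta>) = wave Q (x, t) \<eta> * wave Q (x + t *\<^sub>R L, t) \<zeta>" for x t \<zeta>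
  proof -
    have "Q (\<eta> + \<zeta>) = Q \<zeta> + L \<bullet> \<zeta> + Q \<eta>"
      using L[of \<zeta>] by (simp add: add.commute)
    then show ?thesis
      by (simp add: wave_def inner_simps algebra_simps flip: exp_add)
  qed
  have "fourier_ext Q (\<lambda>\<xi>. f (\<xi> - \<eta>)) (x, t) = wave Q (x, t) \<eta> * fourier_ext Q f (x + t *\<^sub>R L, t)" for x t
  proof -
    have "fourier_ext Q (\<lambda>\<xi>. f (\<xi> - \<eta>)) (x, t)
        = (LINT \<xi>|distr lborel borel ((+) \<eta>). f (\<xi> - \<eta>) * wave Q (x, t) \<xi>)"
      by (simp add: fourier_ext_def lborel_distr_plus)
    also have "\<dots> = (LINT \<zeta>|lborel. f \<zeta> * wave Q (x, t) (\<zeta> + \<eta>))"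
      by (subst integral_distr) (simp_all add: add.commute)
    also have "\<dots> = wave Q (x, t) \<eta> * fourier_ext Q f (x + t *\<^sub>R L, t)"
      by (simp add: fourier_ext_def wave_shift mult.left_commute[of "f \<zeta>" for \<zeta>])
    finally show ?thesis .
  qed
  then have "energy Q p R (\<lambda>\<xi>. f (\<xi> - \<eta>)) = (\<integral>\<^sup>+(x, t). \<psi> (x + t *\<^sub>R L, t) \<partial>lborel)"
    unfolding energy_def
    by (intro nn_integral_cong) (auto simp: \<psi>_def norm_mult indicator_def)
  also have "\<dots> = (\<integral>\<^sup>+t. \<integral>\<^sup>+x. \<psi> (x + t *\<^sub>R L, t) \<partial>lborel \<partial>lborel)"
    by (subst lborel_prod[symmetric], subst lborel_pair.nn_integral_snd[symmetric]) auto
  \<comment> \<open>For fixed \<open>t\<close> the shear is a translation in \<open>x\<close>; this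
    is why the \<open>x\<close> integral was put inside.\<close>
  also have "\<dots> = (\<integral>\<^sup>+t. \<integral>\<^sup>+x. \<psi> (x, t) \<partial>lborel \<partial>lborel)"
  proof (rule nn_integral_cong)
    fix t :: real
    have "(\<integral>\<^sup>+x. \<psi> (x, t) \<partial>distr lborel borel ((+) (t *\<^sub>R L))) = (\<integral>\<^sup>+x. \<psi> (x + t *\<^sub>R L, t) \<partial>lborel)"
      by (subst nn_integral_distr) (simp_all add: add.commute)
    then show "(\<integral>\<^sup>+x. \<psi> (x + t *\<^sub>R L, t) \<partial>lborel) = (\<integral>\<^sup>+x. \<psi> (x, t) \<partial>lborel)"
      by (simp add: lborel_distr_plus)
  qed
  also have "\<dots> = energy Q p R f"
    using lborel_pair.nn_integral_snd[of \<psi>] \<psi> by (simp add: borel_prod lborel_prod energy_def \<psi>_def[abs_def])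
  finally show ?thesis .
qed

section \<open>Functions with disjoint supports\<close>

text \<open>Disjointness keeps the nonzero values of \<open>g + h\<close> and \<open>g - h\<close>
  unimodular, so each has energy at most \<open>K\<close>. Integrating
  \<open>norm_powr_parallelogram\<close> bounds twice the left side by \<open>2 * K\<close>.\<close>

lemma energy_disjoint_add:
  fixes g h :: "real ^ 'n \<Rightarrow> complex"
  assumes [measurable]: "Q \<in> borel_measurable borel"
    and gh: "g \<in> phases" "h \<in> phases" and disj: "\<And>\<xi>. g \<xi> = 0 \<or> h \<xi> = 0" and p: "2 \<le> p"
    and K: "\<And>F. F \<in> phases \<Longrightarrow> energy Q p R F \<le> K"
  shows "energy Q p R g + energy Q p R h \<le> K"
proof -
  have [measurable]: "g \<in> borel_measurable borel" "h \<in> borel_measurable borel"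
    using gh by (auto intro: phases_measurable)
  let ?s = "\<lambda>\<xi>. g \<xi> + h \<xi>" and ?d = "\<lambda>\<xi>. g \<xi> - h \<xi>"
  have "?s \<in> phases" "?d \<in> phases"
    using gh disj unfolding phases_def by (auto, (metis add_0 add.right_neutral diff_0 diff_zero norm_minus_cancel)+)
  have ext_eq: "fourier_ext Q ?s z = fourier_ext Q g z + fourier_ext Q h z" "fourier_ext Q ?d z = fourier_ext Q g z - fourier_ext Q h z" for z
    using gh[THEN integrable_phases, of Q z] by (simp_all add: fourier_ext_def algebra_simps)
  let ?i = "indicator (UNIV \<times> {-R..R}) :: (real^'n) \<times> real \<Rightarrow> ennreal"
  have "2 * (energy Q p R g + energy Q p R h)
      = (\<integral>\<^sup>+z. 2 * (ennreal (norm (fourier_ext Q g z) powr p) * ?i z + ennreal (norm (fourier_ext Q h z) powr p) * ?i z) \<partial>lborel)"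
    unfolding energy_def by (subst nn_integral_cmult, measurable) (subst nn_integral_add, auto)
  also have "\<dots> \<le> (\<integral>\<^sup>+z. ennreal (norm (fourier_ext Q ?s z) powr p) * ?i z + ennreal (norm (fourier_ext Q ?d z) powr p) * ?i z \<partial>lborel)"
  proof (rule nn_integral_mono)
    fix z
    have "ennreal (2 * (norm (fourier_ext Q g z) powr p + norm (fourier_ext Q h z) powr p))
        \<le> ennreal (norm (fourier_ext Q ?s z) powr p + norm (fourier_ext Q ?d z) powr p)"
      unfolding ext_eq using norm_powr_parallelogram[OF p] by (rule ennreal_leI)
    then have "2 * (ennreal (norm (fourier_ext Q g z) powr p) + ennreal (norm (fourier_ext Q h z) powr p))
        \<le> ennreal (norm (fourier_ext Q ?s z) powr p) + ennreal (norm (fourier_ext Q ?d z) powr p)"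
      by (simp add: ennreal_mult ennreal_plus del: ennreal_plus[symmetric])
    then show "2 * (ennreal (norm (fourier_ext Q g z) powr p) * ?i z + ennreal (norm (fourier_ext Q h z) powr p) * ?i z)
        \<le> ennreal (norm (fourier_ext Q ?s z) powr p) * ?i z + ennreal (norm (fourier_ext Q ?d z) powr p) * ?i z"
      by (auto simp: indicator_def)
  qed
  also have "\<dots> = energy Q p R ?s + energy Q p R ?d"
    unfolding energy_def by (simp add: nn_integral_add)
  also have "\<dots> \<le> K + K"
    by (intro add_mono K) fact+
  also have "\<dots> = 2 * K" by (simp add: mult_2)
  finally show ?thesis by (subst (asm) ennreal_mult_le_mult_iff) auto
qed

lemma measure_support_le_1:
  assumes "g \<in> phases"
  shows "measure lborel {\<xi>. g \<xi> \<noteq> 0} \<le> 1"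
proof -
  have [measurable]: "g \<in> borel_measurable borel" using assms by (rule phases_measurable)
  have "measure lborel {\<xi>. g \<xi> \<noteq> 0} \<le> measure lborel (unit_cube :: (real ^ 'a) set)"
    by (rule measure_mono_fmeasurable)
      (use phases_eq_0[OF assms] in \<open>auto simp: fmeasurable_def emeasure_unit_cube\<close>)
  then show ?thesis by (simp add: measure_def emeasure_unit_cube)
qed

section \<open>Uniform random shifts\<close>

text \<open>The box is the set of differences of two points of the cube. It therefore contains every
  shift that carries one point of the cube to another, which makes the probabilities below
  independent of the point.\<close>

definition shifts :: "(real ^ 'n) measure" where
  "shifts = uniform_measure lborel (cbox (-1) 1)"

lemma emeasure_shift_box: "emeasure lborel (cbox (-1) (1 :: real ^ 'n)) = ennreal (2 ^ CARD('n))"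
proof -
  have *: "1 \<bullet> b = 1" if "b \<in> Basis" for b :: "real ^ 'n"
    using that by (auto simp: Basis_vec_def inner_axis)
  have "(\<Prod>b\<in>Basis. (1 - (-1) :: real ^ 'n) \<bullet> b) = (\<Prod>b\<in>(Basis :: (real ^ 'n) set). 2::real)"
    by (rule prod.cong[OF refl]) (simp only: inner_diff_left inner_minus_left *)
  then show ?thesis
    by (simp add: emeasure_lborel_cbox_eq *)
qed

lemma prob_space_shifts: "prob_space (shifts :: (real ^ 'n) measure)"
  unfolding shifts_def by (rule prob_space_uniform_measure) (simp_all add: emeasure_shift_box)

lemma sets_shifts [measurable_cong]: "sets shifts = sets borel"
  by (simp add: shifts_def)

lemma space_shifts [simp]: "space shifts = UNIV"
  by (simp add: shifts_def)

lemma measure_shifts: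
  fixes A :: "(real ^ 'n) set"
  assumes "A \<in> sets borel"
  shows "measure shifts A = measure lborel (cbox (-1) 1 \<inter> A) / 2 ^ CARD('n)"
proof -
  have "measure lborel (cbox (-1) (1 :: real ^ 'n)) = 2 ^ CARD('n)"
    by (simp add: measure_def emeasure_shift_box)
  then show ?thesis
    using assms unfolding shifts_def by (subst measure_uniform_measure) (auto simp: emeasure_shift_box)
qed

lemma lborel_reflect: "distr lborel borel (\<lambda>\<eta>. \<xi> - \<eta>) = (lborel :: 'a::euclidean_space measure)"
  by (subst lborel_affine[of "-1" \<xi>]) (auto simp: density_1 one_ennreal_def[symmetric])

text \<open>The event is a reflected translate of \<open>E\<close>, lying entirely inside the box of
  shifts; Lebesgue measure is invariant under reflection and translation.\<close>

lemma measure_shifts_hit: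
  fixes E :: "(real ^ 'n) set"
  assumes E: "E \<in> sets borel" "E \<subseteq> unit_cube" and \<xi>: "\<xi> \<in> unit_cube"
  shows "measure shifts {\<eta>. \<xi> - \<eta> \<in> E} = measure lborel E / 2 ^ CARD('n)"
proof -
  have [measurable]: "E \<in> sets borel" by fact
  have "\<eta> \<in> cbox (-1) 1" if "\<xi> - \<eta> \<in> E" for \<eta>
  proof -
    have "\<xi> - \<eta> \<in> unit_cube" using that E by blast
    with \<xi> have "-1 \<le> \<eta> $ i \<and> \<eta> $ i \<le> 1" for i
      unfolding unit_cube_def by (auto dest!: spec[of _ i])
    then show ?thesis by (auto simp: mem_box_cart)
  qed
  then have "cbox (-1) 1 \<inter> {\<eta>. \<xi> - \<eta> \<in> E} = (\<lambda>\<eta>. \<xi> - \<eta>) -` E \<inter> space lborel"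
    by auto
  moreover have "measure (distr lborel borel (\<lambda>\<eta>. \<xi> - \<eta>)) E = measure lborel ((\<lambda>\<eta>. \<xi> - \<eta>) -` E \<inter> space lborel)"
    by (rule measure_distr) auto
  ultimately show ?thesis
    by (subst measure_shifts) (auto simp: lborel_reflect)
qed

lemma measure_shifts_stay:
  fixes \<xi> :: "real ^ 'n"
  assumes \<xi>: "\<xi> \<in> unit_cube"
  shows "measure shifts {\<eta>. \<xi> + \<eta> \<in> unit_cube} = 1 / 2 ^ CARD('n)"
proof -
  have "\<eta> \<in> cbox (-1) 1" if "\<xi> + \<eta> \<in> unit_cube" for \<eta>
  proof -
    have "-1 \<le> \<eta> $ i \<and> \<eta> $ i \<le> 1" for i
      using \<xi> that unfolding unit_cube_def by (auto dest!: spec[of _ i])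
    then show ?thesis by (auto simp: mem_box_cart)
  qed
  then have "cbox (-1) 1 \<inter> {\<eta>. \<xi> + \<eta> \<in> unit_cube} = (+) \<xi> -` unit_cube \<inter> space lborel"
    by auto
  moreover have "measure (distr lborel borel ((+) \<xi>)) unit_cube = measure lborel ((+) \<xi> -` unit_cube \<inter> space lborel)"
    by (rule measure_distr) auto
  ultimately show ?thesis
    by (subst measure_shifts) (auto simp: lborel_distr_plus measure_def emeasure_unit_cube)
qed

section \<open>The insertion inequality and the support bound\<close>

lemma energy_insertion:
  fixes f F :: "real ^ 'n \<Rightarrow> complex" and p :: real
  defines "\<delta> \<equiv> measure lborel {\<xi>. f \<xi> \<noteq> 0} / 2 ^ CARD('n)" and "c \<equiv> 1 / 2 ^ CARD('n)"
  assumes Q: "quadratic_form Q" and p: "2 \<le> p" and f: "f \<in> phases" and F: "F \<in> phases"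
    and K: "\<And>F. F \<in> phases \<Longrightarrow> energy Q p R F \<le> K"
  shows "ennreal ((1 - \<delta>) powr p) * energy Q p R F + ennreal (c powr p) * energy Q p R f \<le> K"
proof -
  note [measurable] = quadratic_form_borel[OF Q]
  interpret prob_space "shifts :: (real ^ 'n) measure" by (rule prob_space_shifts)
  have f_meas [measurable]: "f \<in> borel_measurable borel" and [measurable]: "F \<in> borel_measurable borel"
    using f F by (auto intro: phases_measurable)
  \<comment> \<open>\<open>?g\<close> is \<open>F\<close> with the support of the shifted
    \<open>f\<close> removed, and \<open>?h\<close> is the shifted \<open>f\<close> cut to the cube,
    so their supports are disjoint. Shifting \<open>?h\<close> back gives \<open>?k\<close>, a
    random restriction of the fixed function \<open>f\<close>, to which
    \<open>energy_average_ge\<close> applies.\<close>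
  let ?g = "\<lambda>\<eta> \<xi>. if f (\<xi> - \<eta>) = 0 then F \<xi> else 0"
  let ?k = "\<lambda>\<eta> \<xi>. if \<xi> + \<eta> \<in> unit_cube then f \<xi> else 0"
  let ?h = "\<lambda>\<eta> \<xi>. if \<xi> \<in> unit_cube then f (\<xi> - \<eta>) else 0"
  define E where "E = {\<xi>. f \<xi> \<noteq> 0}"
  have E: "E \<in> sets borel" "E \<subseteq> unit_cube"
    using f phases_eq_0[OF f] by (auto simp: E_def)
  have hit: "prob {\<eta> \<in> space shifts. f (\<xi> - \<eta>) = 0} = 1 - \<delta>" if "\<xi> \<in> unit_cube" for \<xi>
  proof -
    have "{\<eta> \<in> space shifts. f (\<xi> - \<eta>) = 0} = space shifts - {\<eta>. \<xi> - \<eta> \<in> E}"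
      by (auto simp: E_def)
    also have "prob \<dots> = 1 - prob {\<eta>. \<xi> - \<eta> \<in> E}"
      unfolding E_def by (rule prob_compl) measurable
    finally show ?thesis
      using measure_shifts_hit[OF E that] by (simp add: \<delta>_def E_def)
  qed
  \<comment> \<open>Any point of the cube exhibits \<open>1 - \<delta>\<close> as a probability,
    hence nonnegative.\<close>
  have "0 \<in> (unit_cube :: (real ^ 'n) set)" by (simp add: unit_cube_def)
  then have \<delta>1: "0 \<le> 1 - \<delta>" using hit[of 0] measure_nonneg by metis
  have "ennreal ((1 - \<delta>) powr p) * energy Q p R F \<le> (\<integral>\<^sup>+\<eta>. energy Q p R (?g \<eta>) \<partial>shifts)"
    by (rule energy_average_ge[where S = "\<lambda>\<eta> \<xi>. f (\<xi> - \<eta>) = 0"]) (use F hit \<delta>1 p in auto)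
  moreover have "ennreal (c powr p) * energy Q p R f \<le> (\<integral>\<^sup>+\<eta>. energy Q p R (?k \<eta>) \<partial>shifts)"
    by (rule energy_average_ge[where S = "\<lambda>\<eta> \<xi>. \<xi> + \<eta> \<in> unit_cube"])
      (use f measure_shifts_stay p in \<open>auto simp: c_def\<close>)
  moreover have "energy Q p R (?k \<eta>) = energy Q p R (?h \<eta>)" for \<eta>
  proof -
    have "?h \<eta> = (\<lambda>\<xi>. ?k \<eta> (\<xi> - \<eta>))" by auto
    then show ?thesis using energy_translate[OF Q, of "?k \<eta>" p R \<eta>] by simp
  qed
  ultimately have "ennreal ((1 - \<delta>) powr p) * energy Q p R F + ennreal (c powr p) * energy Q p R f
      \<le> (\<integral>\<^sup>+\<eta>. energy Q p R (?g \<eta>) \<partial>shifts) + (\<integral>\<^sup>+\<eta>. energy Q p R (?h \<eta>) \<partial>shifts)"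
    by (simp add: add_mono)
  also have "\<dots> = (\<integral>\<^sup>+\<eta>. energy Q p R (?g \<eta>) + energy Q p R (?h \<eta>) \<partial>shifts)"
    by (rule nn_integral_add[symmetric]; rule energy_measurable; measurable)
  also have "\<dots> \<le> (\<integral>\<^sup>+\<eta>. K \<partial>(shifts :: (real ^ 'n) measure))"
  proof (rule nn_integral_mono)
    fix \<eta> :: "real ^ 'n"
    have "?g \<eta> \<in> phases" by (rule phases_if[OF F]) measurable
    moreover have "?h \<eta> \<in> phases"
      using f by (auto simp: phases_def)
    ultimately show "energy Q p R (?g \<eta>) + energy Q p R (?h \<eta>) \<le> K"
      by (intro energy_disjoint_add K p) auto
  qed
  also have "\<dots> = K" by (simp add: emeasure_space_1[simplified])
  finally show ?thesis .
qed

text \<open>Inserting a shifted \<open>f\<close> costs \<open>F\<close> at most a fraction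
  \<open>p * \<delta>\<close> of its energy, while the total cannot exceed the supremum. With
  \<open>F\<close> nearly extremal, the energy of \<open>f\<close> is at most proportional to its
  support.\<close>

lemma energy_le_support:
  fixes f :: "real ^ 'n \<Rightarrow> complex" and p :: real
  assumes Q: "quadratic_form Q" and p: "2 \<le> p" and f: "f \<in> phases"
    and C0: "0 \<le> C" and C: "\<And>F. F \<in> phases \<Longrightarrow> energy Q p R F \<le> ennreal C"
  shows "energy Q p R f \<le> ennreal ((2 ^ CARD('n)) powr p * p * measure lborel {\<xi>. f \<xi> \<noteq> 0} * C)"
proof -
  \<comment> \<open>The rearrangement needs the same number on both sides, hence the exact supremum
    instead of \<open>C\<close>. The bound \<open>C\<close> makes it finite, so that it can be
    subtracted as a real.\<close>
  define K where "K = (SUP F\<in>phases. energy Q p R F)"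
  define k where "k = enn2real K"
  have KC: "K \<le> ennreal C" unfolding K_def by (rule SUP_least) (rule C)
  then have Kk: "K = ennreal k" by (simp add: k_def top.not_eq_extremum le_less_trans)
  have k: "0 \<le> k" by (simp add: k_def)
  have K: "energy Q p R F \<le> ennreal k" if "F \<in> phases" for F
    unfolding Kk[symmetric] K_def using that by (rule SUP_upper)
  define e where "e F = enn2real (energy Q p R F)" for F
  have e: "energy Q p R F = ennreal (e F)" if "F \<in> phases" for F
    using K[OF that] by (simp add: e_def top.not_eq_extremum le_less_trans)
  have e0: "0 \<le> e F" for F by (simp add: e_def)
  define \<delta> where "\<delta> = measure lborel {\<xi>. f \<xi> \<noteq> 0} / 2 ^ CARD('n)"
  define c where "c = 1 / (2::real) ^ CARD('n)"
  note m1 = measure_support_le_1[OF f]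
  \<comment> \<open>The dimension is at least 1, so \<open>\<delta>\<close> is at most one half and
    division by \<open>(1 - \<delta>) powr p\<close> is allowed.\<close>
  have "(2::real) ^ 1 \<le> 2 ^ CARD('n)"
    by (rule power_increasing) (auto simp: Suc_le_eq)
  then have \<delta>: "0 \<le> \<delta>" "\<delta> < 1" using m1 by (auto simp: \<delta>_def divide_simps)
  have c: "0 < c" by (simp add: c_def)
  have ins: "(1 - \<delta>) powr p * e F + c powr p * e f \<le> k" if "F \<in> phases" for F
    using energy_insertion[OF Q p f that K, folded \<delta>_def c_def] k e0
    by (simp add: e that f flip: ennreal_mult ennreal_plus)
  \<comment> \<open>The right side is free of \<open>F\<close>, so the supremum over
    \<open>F\<close> can be taken after dividing.\<close>
  have "K \<le> ennreal ((k - c powr p * e f) / (1 - \<delta>) powr p)"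
    unfolding K_def using ins \<delta> by (intro SUP_least) (auto simp: e ennreal_leI field_simps)
  moreover have "0 \<le> k - c powr p * e f"
    using ins[OF f] e0[of f] by (smt (verit) mult_nonneg_nonneg powr_ge_zero)
  ultimately have "k \<le> (k - c powr p * e f) / (1 - \<delta>) powr p"
    using \<delta> unfolding Kk by (subst (asm) ennreal_le_iff) auto
  then have "c powr p * e f \<le> k * (1 - (1 - \<delta>) powr p)"
    using \<delta> by (simp add: field_simps)
  \<comment> \<open>Bernoulli's inequality, as the tangent bound at 1.\<close>
  also have "\<dots> \<le> k * (p * \<delta>)"
    using powr_ge_tangent[of "1 - \<delta>" 1 p] \<delta> p k by (intro mult_left_mono) auto
  finally have "e f \<le> (p * \<delta>) * k / c powr p"
    using c by (simp add: field_simps)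
  also have "\<dots> = (2 ^ CARD('n)) powr p * p * \<delta> * k"
    by (simp add: c_def powr_divide)
  also have "\<dots> \<le> (2 ^ CARD('n)) powr p * p * measure lborel {\<xi>. f \<xi> \<noteq> 0} * C"
  proof -
    have "\<delta> \<le> measure lborel {\<xi>. f \<xi> \<noteq> 0}" by (simp add: \<delta>_def divide_simps mult_le_cancel_left1)
    moreover have "k \<le> C"
      using KC C0 unfolding Kk by simp
    ultimately show ?thesis using p k \<delta> by (intro mult_mono) auto
  qed
  finally show ?thesis using f by (simp add: e ennreal_leI)
qed

section \<open>Passage from Lebesgue functions on the cube to Borel representatives\<close>

definition represents :: "(real ^ 'n \<Rightarrow> complex) \<Rightarrow> (real ^ 'n \<Rightarrow> complex) \<Rightarrow> bool" where
  "represents g f \<longleftrightarrow> g \<in> phases \<and> f \<in> unimodular_or_zero \<and>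
     (AE \<xi> in lebesgue. indicator unit_cube \<xi> *\<^sub>R f \<xi> = g \<xi>)"

lemma cube_measurable_iff:
  "f \<in> borel_measurable (lebesgue_on unit_cube) \<longleftrightarrow>
     (\<lambda>\<xi>. indicator unit_cube \<xi> *\<^sub>R f \<xi>) \<in> borel_measurable lebesgue" for f :: "real ^ 'n \<Rightarrow> complex"
  by (rule borel_measurable_restrict_space_iff) (simp add: unit_cube_eq_cbox)

lemma represents_self: "g \<in> phases \<Longrightarrow> represents g g"
proof -
  assume g: "g \<in> phases"
  have "indicator unit_cube \<xi> *\<^sub>R g \<xi> = g \<xi>" for \<xi>
    using phases_eq_0[OF g] by (auto simp: indicator_def)
  then show "represents g g"
    using g phases_measurable[OF g]
    by (auto simp: represents_def unimodular_or_zero_def cube_measurable_iff phases_def measurable_completion)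
qed

lemma represents_ex:
  assumes "f \<in> unimodular_or_zero"
  shows "\<exists>g. represents g f"
proof -
  define h where "h \<xi> = indicator unit_cube \<xi> *\<^sub>R f \<xi>" for \<xi>
  have h: "h \<in> borel_measurable lebesgue"
    using assms unfolding h_def by (simp add: unimodular_or_zero_def cube_measurable_iff)
  have "(\<lambda>\<xi>. Re (h \<xi>)) \<in> borel_measurable lebesgue" "(\<lambda>\<xi>. Im (h \<xi>)) \<in> borel_measurable lebesgue"
    using h by measurable
  then obtain r i where [measurable]: "r \<in> borel_measurable lborel" "i \<in> borel_measurable lborel"
    and ri: "AE \<xi> in lborel. Re (h \<xi>) = r \<xi>" "AE \<xi> in lborel. Im (h \<xi>) = i \<xi>"
    using completion_ex_borel_measurable_real by metis
  \<comment> \<open>Forcing modulus 1 or value 0 puts \<open>g\<close> in \<open>phases\<close>.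
    Where \<open>r\<close> and \<open>i\<close> agree with the parts of \<open>h\<close>, every
    point failing the condition has \<open>h \<xi> = 0\<close>, so nothing changes almost
    everywhere.\<close>
  define g where "g \<xi> = (if \<xi> \<in> unit_cube \<and> (r \<xi>)\<^sup>2 + (i \<xi>)\<^sup>2 = 1
    then complex_of_real (r \<xi>) + \<i> * complex_of_real (i \<xi>) else 0)" for \<xi>
  have "g \<in> borel_measurable borel"
    unfolding g_def by measurable
  then have g: "g \<in> phases"
    by (auto simp: phases_def g_def cmod_def)
  have "h \<xi> = 0 \<or> \<xi> \<in> unit_cube \<and> norm (h \<xi>) = 1" for \<xi>
    using assms by (auto simp: h_def indicator_def unimodular_or_zero_def)
  then have h': "h \<xi> = 0 \<or> \<xi> \<in> unit_cube \<and> (Re (h \<xi>))\<^sup>2 + (Im (h \<xi>))\<^sup>2 = 1" for \<xi>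
    by (metis cmod_power2 one_power2)
  have "AE \<xi> in lborel. h \<xi> = g \<xi>"
    using ri
  proof eventually_elim
    case (elim \<xi>)
    then show ?case
      using h'[of \<xi>] by (cases "h \<xi> = 0") (auto simp: g_def complex_eq_iff)
  qed
  then have "AE \<xi> in lebesgue. h \<xi> = g \<xi>" by (rule AE_completion)
  with g assms show ?thesis unfolding h_def represents_def by blast
qed

text \<open>Equality holds at every point, since a null change of the integrand leaves the integral
  alone.\<close>

lemma extension_op_eq_fourier_ext:
  assumes "represents g f" and Q: "Q \<in> borel_measurable borel"
  shows "extension_op Q f = fourier_ext Q g"
proof (rule ext, clarify)
  fix x :: "real ^ 'a" and t
  have wave: "wave Q (x, t) \<in> borel_measurable lebesgue"
    by (rule measurable_completion) (use Q in measurable)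
  have f: "(\<lambda>\<xi>. indicator unit_cube \<xi> *\<^sub>R f \<xi>) \<in> borel_measurable lebesgue"
    using assms by (simp add: represents_def unimodular_or_zero_def cube_measurable_iff)
  have g: "g \<in> borel_measurable borel"
    using assms phases_measurable by (auto simp: represents_def)
  then have g': "g \<in> borel_measurable lebesgue"
    by (simp add: measurable_completion)
  have "extension_op Q f (x, t) = (LINT \<xi>|lebesgue. indicator unit_cube \<xi> *\<^sub>R (f \<xi> * wave Q (x, t) \<xi>))"
    unfolding extension_op_def wave_def
    by (simp, subst integral_restrict_space) (auto simp: unit_cube_eq_cbox)
  also have "\<dots> = (LINT \<xi>|lebesgue. (indicator unit_cube \<xi> *\<^sub>R f \<xi>) * wave Q (x, t) \<xi>)"
    by simp
  also have "\<dots> = (LINT \<xi>|lebesgue. g \<xi> * wave Q (x, t) \<xi>)"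
  proof (rule integral_cong_AE)
    show "AE \<xi> in lebesgue. indicator unit_cube \<xi> *\<^sub>R f \<xi> * wave Q (x, t) \<xi> = g \<xi> * wave Q (x, t) \<xi>"
    proof -
      have "AE \<xi> in lebesgue. indicator unit_cube \<xi> *\<^sub>R f \<xi> = g \<xi>"
        using assms by (simp add: represents_def)
      then show ?thesis by eventually_elim (simp only:)
    qed
  qed (intro borel_measurable_times f g' wave)+
  also have "\<dots> = fourier_ext Q g (x, t)"
    unfolding fourier_ext_def by (rule integral_completion) (use g Q in measurable)
  finally show "extension_op Q f (x, t) = fourier_ext Q g (x, t)" .
qed

lemma Lp_norm_slab_eq:
  assumes "represents g f" and Q: "Q \<in> borel_measurable borel" and p: "0 < p"
  shows "Lp_norm (lebesgue_on (slab R)) (ennreal p) (extension_op Q f) =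
    (if energy Q p R g = \<infinity> then \<infinity> else ennreal (enn2real (energy Q p R g) powr (1 / p)))"
proof -
  have "(\<integral>\<^sup>+z. ennreal (norm (fourier_ext Q g z) powr p) \<partial>lebesgue_on (slab R)) = energy Q p R g"
    unfolding energy_def slab_def
    by (subst nn_integral_restrict_space) (simp_all add: nn_integral_completion)
  then show ?thesis
    using p unfolding Lp_norm_def extension_op_eq_fourier_ext[OF assms(1,2)] by (simp add: Let_def)
qed

text \<open>Values of modulus 0 or 1 make the \<open>q\<close>-th power of the modulus the indicator
  of the support.\<close>

lemma Lp_norm_cube_eq:
  assumes "represents g f" and q: "0 < q"
  shows "Lp_norm (lebesgue_on unit_cube) (ennreal q) f = ennreal (measure lborel {\<xi>. g \<xi> \<noteq> 0} powr (1 / q))"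
proof -
  have g: "g \<in> phases" using assms by (simp add: represents_def)
  have [measurable]: "g \<in> borel_measurable borel" using g by (rule phases_measurable)
  have "(\<integral>\<^sup>+\<xi>. ennreal (norm (f \<xi>) powr q) \<partial>lebesgue_on unit_cube)
      = (\<integral>\<^sup>+\<xi>. ennreal (norm (f \<xi>) powr q) * indicator unit_cube \<xi> \<partial>lebesgue)"
    by (rule nn_integral_restrict_space) (simp add: unit_cube_eq_cbox)
  also have "\<dots> = (\<integral>\<^sup>+\<xi>. indicator {\<xi>. g \<xi> \<noteq> 0} \<xi> \<partial>lebesgue)"
  proof (rule nn_integral_cong_AE)
    have "AE \<xi> in lebesgue. indicator unit_cube \<xi> *\<^sub>R f \<xi> = g \<xi>"
      using assms by (simp add: represents_def)
    then show "AE \<xi> in lebesgue. ennreal (norm (f \<xi>) powr q) * indicator unit_cube \<xi> = indicator {\<xi>. g \<xi> \<noteq> 0} \<xi>"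
    proof eventually_elim
      case (elim \<xi>)
      have "g \<xi> = 0 \<or> norm (g \<xi>) = 1" using g by (auto simp: phases_def)
      with elim q show ?case by (cases "\<xi> \<in> unit_cube") (auto simp: indicator_def)
    qed
  qed
  also have "\<dots> = emeasure lborel {\<xi>. g \<xi> \<noteq> 0}"
    by (simp add: nn_integral_completion)
  also have "\<dots> = ennreal (measure lborel {\<xi>. g \<xi> \<noteq> 0})"
  proof (rule emeasure_eq_ennreal_measure)
    have "emeasure lborel {\<xi>. g \<xi> \<noteq> 0} \<le> emeasure lborel (unit_cube :: (real ^ 'a) set)"
      by (rule emeasure_mono) (use phases_eq_0[OF g] in auto)
    then show "emeasure lborel {\<xi>. g \<xi> \<noteq> 0} \<noteq> top"
      by (auto simp: emeasure_unit_cube top_unique)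
  qed
  finally show ?thesis using q by (simp add: Lp_norm_def Let_def)
qed

lemma Lp_norm_infinity_le_1:
  assumes "f \<in> unimodular_or_zero"
  shows "Lp_norm (lebesgue_on unit_cube) \<infinity> f \<le> 1"
proof -
  have "(\<lambda>\<xi>. ennreal (norm (f \<xi>))) \<in> borel_measurable (lebesgue_on unit_cube)"
    using assms by (auto simp: unimodular_or_zero_def)
  moreover have "AE \<xi> in lebesgue_on unit_cube. ennreal (norm (f \<xi>)) \<le> 1"
    using assms by (intro AE_I2) (fastforce simp: unimodular_or_zero_def)
  ultimately show ?thesis unfolding Lp_norm_def by (simp add: esssup_I)
qed

text \<open>If the essential supremum is below 1, then \<open>f\<close> vanishes almost everywhere
  on the cube and the left side is 0. Otherwise the left side is at most 1, because the support has
  measure at most 1.\<close>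

lemma Lp_norm_le_infinity:
  assumes f: "f \<in> unimodular_or_zero" and q: "0 < q"
  shows "Lp_norm (lebesgue_on unit_cube) (ennreal q) f \<le> Lp_norm (lebesgue_on unit_cube) \<infinity> f"
proof -
  obtain g where g: "represents g f" using represents_ex[OF f] by blast
  then have gph: "g \<in> phases" by (simp add: represents_def)
  have [measurable]: "g \<in> borel_measurable borel" using gph by (rule phases_measurable)
  let ?m = "measure lborel {\<xi>. g \<xi> \<noteq> 0}"
  show ?thesis
  proof (cases "1 \<le> Lp_norm (lebesgue_on unit_cube) \<infinity> f")
    case True
    have "?m powr (1 / q) \<le> 1 powr (1 / q)"
      using measure_support_le_1[OF gph] q by (intro powr_mono2) auto
    then show ?thesis
      using True unfolding Lp_norm_cube_eq[OF g q] by (simp add: order_trans[rotated] ennreal_le_1)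
  next
    case False
    then have "esssup (lebesgue_on unit_cube) (\<lambda>\<xi>. ennreal (norm (f \<xi>))) < 1"
      by (simp add: Lp_norm_def)
    then have "AE \<xi> in lebesgue_on unit_cube. ennreal (norm (f \<xi>)) < 1"
      by (intro eventually_mono[OF esssup_AE]) (rule le_less_trans)
    then have "AE \<xi> in lebesgue. \<xi> \<in> unit_cube \<longrightarrow> ennreal (norm (f \<xi>)) < 1"
      by (subst (asm) AE_restrict_space_iff) (auto simp: unit_cube_eq_cbox)
    moreover have "AE \<xi> in lebesgue. indicator unit_cube \<xi> *\<^sub>R f \<xi> = g \<xi>"
      using g by (simp add: represents_def)
    ultimately have "AE \<xi> in lebesgue. \<not> g \<xi> \<noteq> 0"
    proof eventually_elim
      case (elim \<xi>)
      have "g \<xi> = 0 \<or> norm (g \<xi>) = 1" using gph by (auto simp: phases_def)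
      with elim show ?case by (cases "\<xi> \<in> unit_cube") auto
    qed
    then have "AE \<xi> in lborel. \<not> g \<xi> \<noteq> 0" by (simp add: AE_completion_iff)
    then have "emeasure lborel {\<xi>. g \<xi> \<noteq> 0} = 0"
      by (subst (asm) AE_iff_measurable[OF _ refl]) auto
    then have "?m = 0" by (simp add: measure_def)
    then show ?thesis using Lp_norm_cube_eq[OF g q] by simp
  qed
qed

section \<open>Comparison of the best constants\<close>

lemma best_const_infinity_le:
  assumes "0 < q"
  shows "best_const Q p \<infinity> R \<le> best_const Q p (ennreal q) R"
  unfolding best_const_def
proof (rule Inf_superset_mono, safe)
  fix C and f :: "real ^ 'a \<Rightarrow> complex"
  assume C: "\<forall>f\<in>unimodular_or_zero. Lp_norm (lebesgue_on (slab R)) (ennreal p) (extension_op Q f)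
      \<le> C * Lp_norm (lebesgue_on unit_cube) (ennreal q) f" and f: "f \<in> unimodular_or_zero"
  then have "Lp_norm (lebesgue_on (slab R)) (ennreal p) (extension_op Q f)
      \<le> C * Lp_norm (lebesgue_on unit_cube) (ennreal q) f" by blast
  also have "\<dots> \<le> C * Lp_norm (lebesgue_on unit_cube) \<infinity> f"
    by (intro mult_left_mono Lp_norm_le_infinity f assms) simp
  finally show "Lp_norm (lebesgue_on (slab R)) (ennreal p) (extension_op Q f) \<le> \<dots>" .
qed

text \<open>A constant admissible for the sup norm bounds all energies, and
  \<open>energy_le_support\<close> then gains a factor equal to the measure of the support. Its
  \<open>p\<close>-th root is dominated by the \<open>L^q\<close> norm. \<open>A\<close> is only
  bounded below, leaving room to enlarge it.\<close>

lemma best_const_le_infinity: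
  fixes Q :: "real ^ 'n \<Rightarrow> real"
  assumes Q: "quadratic_form Q" and p: "2 \<le> p" and q: "p < q"
    and A: "((2 ^ CARD('n)) powr p * p) powr (1 / p) \<le> A"
  shows "best_const Q p (ennreal q) R \<le> ennreal A * best_const Q p \<infinity> R"
proof -
  note Qm = quadratic_form_borel[OF Q]
  have p0: "0 < p" and q0: "0 < q" using p q by auto
  have "0 < ((2 ^ CARD('n)) powr p * p) powr (1 / p)" using p0 by simp
  with A have A0: "0 < A" by linarith
  have "best_const Q p (ennreal q) R \<le> ennreal A * C"
    if C: "\<forall>f\<in>unimodular_or_zero. Lp_norm (lebesgue_on (slab R)) (ennreal p) (extension_op Q f)
      \<le> C * Lp_norm (lebesgue_on unit_cube) \<infinity> f" for C
  proof (cases "C = \<infinity>")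
    case True
    then show ?thesis using A0 by (simp add: ennreal_mult_top)
  next
    case False
    then obtain c where c: "C = ennreal c" "0 \<le> c" by (cases C) auto
    \<comment> \<open>Functions in \<open>phases\<close> have sup norm at most 1, so testing
      \<open>C\<close> on them bounds every energy by \<open>c powr p\<close>.\<close>
    have en: "energy Q p R F \<le> ennreal (c powr p)" if F: "F \<in> phases" for F
    proof -
      have rF: "represents F F" using F by (rule represents_self)
      then have Fu: "F \<in> unimodular_or_zero" by (simp add: represents_def)
      have "Lp_norm (lebesgue_on (slab R)) (ennreal p) (extension_op Q F) \<le> C * 1"
        using C Fu Lp_norm_infinity_le_1[OF Fu] by (meson mult_left_mono order_trans zero_le)
      then have le: "(if energy Q p R F = \<infinity> then \<infinity> else ennreal (enn2real (energy Q p R F) powr (1 / p))) \<le> ennreal c"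
        unfolding Lp_norm_slab_eq[OF rF Qm p0] c by simp
      then have fin: "energy Q p R F \<noteq> \<infinity>" by (auto split: if_splits simp: top_unique)
      with le c have "enn2real (energy Q p R F) powr (1 / p) \<le> c" by simp
      then have "(enn2real (energy Q p R F) powr (1 / p)) powr p \<le> c powr p"
        using p0 by (intro powr_mono2) auto
      then have "enn2real (energy Q p R F) \<le> c powr p"
        using p0 by (simp add: powr_powr)
      then show ?thesis using fin by (simp add: enn2real_le)
    qed
    show ?thesis unfolding best_const_def
    proof (rule Inf_lower, safe)
      fix f :: "real ^ 'n \<Rightarrow> complex" assume "f \<in> unimodular_or_zero"
      then obtain g where g: "represents g f" using represents_ex by blast
      then have gph: "g \<in> phases" by (simp add: represents_def)
      define m where "m = measure lborel {\<xi>. g \<xi> \<noteq> 0}"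
      have m: "0 \<le> m" "m \<le> 1" using measure_support_le_1[OF gph] by (auto simp: m_def)
      let ?b = "(2 ^ CARD('n)) powr p * p * m * c powr p"
      have b: "energy Q p R g \<le> ennreal ?b"
        unfolding m_def by (rule energy_le_support[OF Q p gph _ en]) auto
      then have fin: "energy Q p R g \<noteq> \<infinity>" by (auto simp: top_unique)
      have "enn2real (energy Q p R g) powr (1 / p) \<le> ?b powr (1 / p)"
        using b m p0 by (intro powr_mono2 enn2real_leI) auto
      also have "\<dots> = ((2 ^ CARD('n)) powr p * p) powr (1 / p) * m powr (1 / p) * c"
        using m p0 c by (simp add: powr_mult powr_powr)
      also have "\<dots> \<le> A * m powr (1 / q) * c"
      proof -
        \<comment> \<open>The base is at most 1, so lowering the exponent from \<open>1 / p\<close>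
          to \<open>1 / q\<close> increases the power.\<close>
        have "m powr (1 / p) \<le> m powr (1 / q)"
          using m p0 q by (intro powr_mono') (auto simp: frac_le)
        then show ?thesis
          using A A0 c by (intro mult_right_mono mult_mono) auto
      qed
      finally have "ennreal (enn2real (energy Q p R g) powr (1 / p)) \<le> ennreal (A * m powr (1 / q) * c)"
        by (rule ennreal_leI)
      also have "\<dots> = ennreal A * C * Lp_norm (lebesgue_on unit_cube) (ennreal q) f"
        using A0 c unfolding Lp_norm_cube_eq[OF g q0] m_def[symmetric]
        by (simp add: ennreal_mult[symmetric] mult_ac)
      finally show "Lp_norm (lebesgue_on (slab R)) (ennreal p) (extension_op Q f) \<le> \<dots>"
        using fin unfolding Lp_norm_slab_eq[OF g Qm p0] by simp
    qed
  qed
  \<comment> \<open>Dividing by \<open>A\<close>, which is finite and nonzero, leaves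
    \<open>C\<close> alone on the right, ready for the infimum; the factor is restored
    afterwards.\<close>
  then have "best_const Q p (ennreal q) R / ennreal A \<le> C"
    if "\<forall>f\<in>unimodular_or_zero. Lp_norm (lebesgue_on (slab R)) (ennreal p) (extension_op Q f)
      \<le> C * Lp_norm (lebesgue_on unit_cube) \<infinity> f" for C
    using that A0 by (intro divide_le_posI_ennreal) (auto simp: mult.commute)
  then have "best_const Q p (ennreal q) R / ennreal A \<le> best_const Q p \<infinity> R"
    unfolding best_const_def[of _ _ \<infinity>] by (intro Inf_greatest) blast
  then have "ennreal A * (best_const Q p (ennreal q) R / ennreal A) \<le> ennreal A * best_const Q p \<infinity> R"
    by (rule mult_left_mono) simp
  moreover have "ennreal A * (b / ennreal A) = b" for b
    using A0 ennreal_mult_divide_eq[of "ennreal A" b] by (simp add: ennreal_times_divide mult.commute)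
  ultimately show ?thesis by simp
qed

theorem theorem1p3:
  fixes Q :: "real ^ 'n \<Rightarrow> real" and p :: real and q :: ennreal
  assumes "quadratic_form Q"
    and "2 \<le> p"
    and "ennreal p < q"
  shows "\<exists>C\<^sub>1::real. C\<^sub>1 > 1 \<and>
           (\<forall>R>1. best_const Q p \<infinity> R \<le> best_const Q p q R \<and>
                  best_const Q p q R \<le> ennreal C\<^sub>1 * best_const Q p \<infinity> R)"
proof (cases "q = \<infinity>")
  case True
  \<comment> \<open>Here the two best constants coincide, so any witness above 1 serves.\<close>
  have "b \<le> ennreal 2 * b" for b
    using mult_right_mono[of 1 "ennreal 2" b] by simp
  with True show ?thesis by (intro exI[of _ 2]) simp
next
  case False
  then obtain q' where q': "q = ennreal q'" "0 \<le> q'" by (cases q) auto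
  with assms have pq: "p < q'" by (simp add: ennreal_less_iff)
  \<comment> \<open>The second entry is the \<open>p\<close>-th root of the constant in
    \<open>energy_le_support\<close>, independent of \<open>R\<close>; the maximum with 2 makes the
    strict bound \<open>1 < A\<close> immediate.\<close>
  define A where "A = max 2 (((2 ^ CARD('n)) powr p * p) powr (1 / p))"
  show ?thesis
  proof (intro exI[of _ A] conjI allI impI)
    show "1 < A" by (simp add: A_def)
    show "best_const Q p \<infinity> R \<le> best_const Q p q R" for R
      unfolding q' using pq assms(2) by (intro best_const_infinity_le) simp
    show "best_const Q p q R \<le> ennreal A * best_const Q p \<infinity> R" for R
      unfolding q' by (rule best_const_le_infinity[OF assms(1,2) pq]) (simp add: A_def)
  qed
qed

end
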